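(* Let $\kappa$ be a regular uncountable cardinal, let $\gamma\le\kappa$ be regular, and assume that $\kappa$ is generically measurable, as witnessed by some ${<}\gamma$-closed notion of forcing $P$. Let $\dot U$ be a $P$-name for a uniform $V$-normal $V$-ultrafilter on $\kappa$, and let $I=\{Y\subseteq\kappa\mid 1_P\Vdash\check Y\notin\dot U\}$ be the hopeless ideal with respect to $\dot U$. Then $I\supseteq \mathrm{bd}_\kappa$ is a normal ideal on $\kappa$, and for any $X\in I^+$, Choose has a winning strategy in the game $\mathcal U(X,I,{<}\gamma)$.
   Context: $\mathrm{bd}_\kappa$ denotes the ideal of bounded subsets of $\kappa$. For a family $I$ of subsets of $\kappa$ closed under subsets, $I^+$ denotes the collection of all subsets of $\kappa$ that are not in $I$ (the $I$-positive sets). The game $\mathcal U(X,I,{<}\gamma)$, for $X\in I^+$: two players, Cut and Choose, play for $\gamma$ many rounds. In each round, Cut divides the set $X$ into two disjoint pieces, and Choose answers by picking one of them. Choose wins if for all $\delta<\gamma$ the intersection of their first $\delta$ many choices is in $I^+$, and Cut wins otherwise. $\kappa$ is generically measurable as witnessed by the notion of forcing $P$ if in every $P$-generic extension $V[G]$ there is a $V$-normal $V$-ultrafilter on $\kappa$ that induces a well-founded (generic) ultrapower of $V$; equivalently, in every $P$-generic extension $V[G]$ there is an elementary embedding $j\colon V\to M$ with critical point $\kappa$ for some transitive $M\subseteq V[G]$. A $V$-ultrafilter on $\kappa$ is uniform if all of its elements have size $\kappa$ in $V$. A notion of forcing is ${<}\gamma$-closed if every decreasing sequence of conditions of length less than $\gamma$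 has a lower bound. *)

theory Defs
  imports "HOL-Library.FuncSet"
begin

unbundle cardinal_syntax

section \<open>The universe of sets\<close>

text \<open>
  The ground model \<open>V\<close> is an arbitrary type \<open>'v\<close> of this class: the elements of \<open>'v\<close> are the sets of
  \<open>V\<close>, and \<open>elts x\<close> is the collection of the members of \<open>x\<close>. Replacement and separation are stated
  for arbitrary functions and predicates; the axiom of choice is inherited from HOL. Hence a
  subcollection of \<open>elts x\<close>, and a function with domain \<open>elts x\<close>, is the same thing as an element
  of \<open>V\<close>, and subsets of and functions on ordinals of \<open>V\<close> are written below as HOL sets and functions.
\<close>

class zfc_universe =
  fixes elts :: "'a \<Rightarrow> 'a set"
  assumes extensionality: "elts x = elts y \<Longrightarrow> x = y"
    and foundation: "wf {(x, y). x \<in> elts y}"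
    and separation: "\<exists>y. elts y = {z \<in> elts x. Q z}"
    and replacement: "\<exists>y. elts y = f ` elts x"
    and pairing: "\<exists>z. elts z = {x, y}"
    and union: "\<exists>y. elts y = \<Union> (elts ` elts x)"
    and powerset: "\<exists>y. elts y = {z. elts z \<subseteq> elts x}"
    and infinity: "\<exists>x. (\<exists>z\<in>elts x. elts z = {}) \<and>
                      (\<forall>y\<in>elts x. \<exists>s\<in>elts x. elts s = insert y (elts y))"

text \<open>The set with members \<open>X\<close>; meaningful only if \<open>X\<close> is set-sized.\<close>
definition vset :: "'v::zfc_universe set \<Rightarrow> 'v" where
  "vset X = (THE x. elts x = X)"

definition vpair :: "'v::zfc_universe \<Rightarrow> 'v \<Rightarrow> 'v" where
  "vpair x y = vset {vset {x}, vset {x, y}}"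

definition vgraph :: "'v::zfc_universe \<Rightarrow> ('v \<Rightarrow> 'v) \<Rightarrow> 'v" where
  "vgraph d f = vset ((\<lambda>x. vpair x (f x)) ` elts d)"

lemma vset_elts [simp]: "vset (elts x) = x"
  unfolding vset_def by (rule the_equality) (auto intro: extensionality)

lemma elts_vset: "elts x = X \<Longrightarrow> elts (vset X) = X"
  by (drule sym) (simp only: vset_elts)

lemma elts_vset_pair [simp]: "elts (vset {x, y}) = {x, y}" for x y :: "'v::zfc_universe"
proof -
  obtain z where "elts z = {x, y}" using pairing[of x y] by (elim exE)
  then show ?thesis by (rule elts_vset)
qed

lemma elts_vset_singleton [simp]: "elts (vset {x}) = {x}" for x :: "'v::zfc_universe"
  using elts_vset_pair[of x x] by simp

lemma elts_vset_subset:
  fixes x :: "'v::zfc_universe"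
  assumes "X \<subseteq> elts x"
  shows "elts (vset X) = X"
proof -
  obtain y where "elts y = {z \<in> elts x. z \<in> X}"
    using separation[of x "\<lambda>z. z \<in> X"] by (elim exE)
  moreover have "{z \<in> elts x. z \<in> X} = X" using assms by auto
  ultimately show ?thesis by (simp only: elts_vset)
qed

lemma elts_vset_image [simp]: "elts (vset (f ` elts x)) = f ` elts x"
  for f :: "'v \<Rightarrow> 'v::zfc_universe"
proof -
  obtain y where "elts y = f ` elts x" using replacement[where f = f and x = x] by (elim exE)
  then show ?thesis by (rule elts_vset)
qed

lemma vset_inject_pair:
  "vset {x, y} = vset {z, w} \<longleftrightarrow> {x, y} = {z, w}" for x y z w :: "'v::zfc_universe"
  using elts_vset_pair[of x y] elts_vset_pair[of z w] by metis

lemma vpair_inject [simp]: "vpair x y = vpair z w \<longleftrightarrow> x = z \<and> y = w"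
  for x y z w :: "'v::zfc_universe"
proof -
  have 1: "vset {a} = vset {b} \<longleftrightarrow> a = b" for a b :: 'v
    using vset_inject_pair[of a a b b] by simp
  have 2: "vset {a} = vset {b, c} \<longleftrightarrow> a = b \<and> a = c" for a b c :: 'v
    using vset_inject_pair[of a a b c] by auto
  have 3: "vset {b, c} = vset {a} \<longleftrightarrow> a = b \<and> a = c" for a b c :: 'v
    using vset_inject_pair[of b c a a] by auto
  show ?thesis
    unfolding vpair_def by (auto simp: vset_inject_pair doubleton_eq_iff 1 2 3)
qed

definition mem_tc :: "('v::zfc_universe \<times> 'v) set" where
  "mem_tc = {(x, y). x \<in> elts y}\<^sup>+"

lemma wf_mem_tc: "wf (mem_tc :: ('v::zfc_universe \<times> 'v) set)"
  unfolding mem_tc_def using foundation by (rule wf_trancl)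

lemma elts_mem_tc: "x \<in> elts y \<Longrightarrow> (x, y) \<in> mem_tc"
  unfolding mem_tc_def by (simp add: r_into_trancl)

lemma vpair_mem_tc:
  assumes "vpair c r \<in> elts a"
  shows "(c, a) \<in> mem_tc"
proof -
  have "vset {c} \<in> elts (vpair c r)" by (simp add: vpair_def)
  then have 1: "(vset {c}, vpair c r) \<in> mem_tc" by (rule elts_mem_tc)
  have 2: "(c, vset {c}) \<in> mem_tc" by (rule elts_mem_tc) simp
  have 3: "(vpair c r, a) \<in> mem_tc" using assms by (rule elts_mem_tc)
  show ?thesis using 1 2 3 unfolding mem_tc_def by (blast intro: trancl_trans)
qed


section \<open>Ordinals and cardinals of the universe\<close>

text \<open>For an ordinal \<open>\<alpha>\<close>, \<open>elts \<alpha>\<close> is the set of all smaller ordinals, ordered by membership.\<close>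
definition is_ordinal :: "'v::zfc_universe \<Rightarrow> bool" where
  "is_ordinal \<alpha> \<longleftrightarrow> (\<forall>x\<in>elts \<alpha>. elts x \<subseteq> elts \<alpha>) \<and>
     (\<forall>x\<in>elts \<alpha>. \<forall>y\<in>elts x. elts y \<subseteq> elts x)"

definition ord_rel :: "'v::zfc_universe \<Rightarrow> 'v rel" where
  "ord_rel \<alpha> = {(x, y). x \<in> elts \<alpha> \<and> y \<in> elts \<alpha> \<and> (x = y \<or> x \<in> elts y)}"

definition regular_cardinal :: "'v::zfc_universe \<Rightarrow> bool" where
  "regular_cardinal \<kappa> \<longleftrightarrow> is_ordinal \<kappa> \<and> infinite (elts \<kappa>) \<and>
     Card_order (ord_rel \<kappa>) \<and> regularCard (ord_rel \<kappa>)"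

definition bounded_ideal :: "'v::zfc_universe \<Rightarrow> 'v set set" where
  "bounded_ideal \<kappa> = {Y. Y \<subseteq> elts \<kappa> \<and> (\<exists>\<beta>\<in>elts \<kappa>. Y \<subseteq> elts \<beta>)}"

definition positive_sets :: "'v::zfc_universe \<Rightarrow> 'v set set \<Rightarrow> 'v set set" where
  "positive_sets \<kappa> I = {Y. Y \<subseteq> elts \<kappa> \<and> Y \<notin> I}"

definition diagonal_intersection :: "'v::zfc_universe \<Rightarrow> ('v \<Rightarrow> 'v set) \<Rightarrow> 'v set" where
  "diagonal_intersection \<kappa> Y = {\<beta> \<in> elts \<kappa>. \<forall>\<alpha>\<in>elts \<beta>. \<beta> \<in> Y \<alpha>}"

definition diagonal_union :: "'v::zfc_universe \<Rightarrow> ('v \<Rightarrow> 'v set) \<Rightarrow> 'v set" where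
  "diagonal_union \<kappa> Y = {\<beta> \<in> elts \<kappa>. \<exists>\<alpha>\<in>elts \<beta>. \<beta> \<in> Y \<alpha>}"

definition ideal_on :: "'v::zfc_universe \<Rightarrow> 'v set set \<Rightarrow> bool" where
  "ideal_on \<kappa> I \<longleftrightarrow> I \<subseteq> Pow (elts \<kappa>) \<and> {} \<in> I \<and> elts \<kappa> \<notin> I \<and>
     (\<forall>Y\<in>I. \<forall>Z. Z \<subseteq> Y \<longrightarrow> Z \<in> I) \<and> (\<forall>Y\<in>I. \<forall>Z\<in>I. Y \<union> Z \<in> I)"

definition normal_ideal_on :: "'v::zfc_universe \<Rightarrow> 'v set set \<Rightarrow> bool" where
  "normal_ideal_on \<kappa> I \<longleftrightarrow> ideal_on \<kappa> I \<and>
     (\<forall>Y. (\<forall>\<alpha>\<in>elts \<kappa>. Y \<alpha> \<in> I) \<longrightarrow> diagonal_union \<kappa> Y \<in> I)"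


section \<open>Forcing\<close>

record 'v forcing =
  conds :: 'v
  leq :: "'v \<Rightarrow> 'v \<Rightarrow> bool"
  top_cond :: 'v

definition notion_of_forcing :: "'v::zfc_universe forcing \<Rightarrow> bool" where
  "notion_of_forcing P \<longleftrightarrow>
     (\<forall>p\<in>elts (conds P). leq P p p) \<and>
     (\<forall>p\<in>elts (conds P). \<forall>q\<in>elts (conds P). \<forall>r\<in>elts (conds P).
        leq P p q \<longrightarrow> leq P q r \<longrightarrow> leq P p r) \<and>
     top_cond P \<in> elts (conds P) \<and> (\<forall>p\<in>elts (conds P). leq P p (top_cond P))"

definition less_closed :: "'v::zfc_universe \<Rightarrow> 'v forcing \<Rightarrow> bool" where
  "less_closed \<gamma> P \<longleftrightarrow> (\<forall>\<delta>\<in>elts \<gamma>. \<forall>s.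
     (\<forall>\<alpha>\<in>elts \<delta>. s \<alpha> \<in> elts (conds P)) \<and>
     (\<forall>\<beta>\<in>elts \<delta>. \<forall>\<alpha>\<in>elts \<beta>. leq P (s \<beta>) (s \<alpha>)) \<longrightarrow>
     (\<exists>q\<in>elts (conds P). \<forall>\<alpha>\<in>elts \<delta>. leq P q (s \<alpha>)))"

definition below :: "'v::zfc_universe forcing \<Rightarrow> 'v \<Rightarrow> 'v set" where
  "below P p = {q \<in> elts (conds P). leq P q p}"

definition dense_below :: "'v::zfc_universe forcing \<Rightarrow> 'v \<Rightarrow> ('v \<Rightarrow> bool) \<Rightarrow> bool" where
  "dense_below P p D \<longleftrightarrow> (\<forall>q\<in>below P p. \<exists>r\<in>below P q. D r)"

inductive is_name :: "'v::zfc_universe forcing \<Rightarrow> 'v \<Rightarrow> bool" for P where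
  "(\<And>z. z \<in> elts x \<Longrightarrow> \<exists>\<tau> p. z = vpair \<tau> p \<and> p \<in> elts (conds P) \<and> is_name P \<tau>) \<Longrightarrow> is_name P x"

function check_name :: "'v::zfc_universe forcing \<Rightarrow> 'v \<Rightarrow> 'v" where
  "check_name P x = vset ((\<lambda>y. vpair (check_name P y) (top_cond P)) ` elts x)"
  by pat_completeness auto
termination
  by (relation "inv_image mem_tc snd") (simp_all add: wf_mem_tc elts_mem_tc)

declare check_name.simps [simp del]

declare conj_cong [fundef_cong]

text \<open>
  \<open>forces_eq P \<sigma> \<tau> p\<close> and \<open>forces_mem P \<sigma> \<tau> p\<close> are the usual recursive definitions of
  \<open>p \<tturnstile> \<sigma> = \<tau>\<close> and \<open>p \<tturnstile> \<sigma> \<in> \<tau>\<close>, where in the former the clauses for \<open>\<sigma> \<subseteq> \<tau>\<close> and \<open>\<tau> \<subseteq> \<sigma>\<close> have the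
  definition of forced membership unfolded.
\<close>
function forces_eq :: "'v::zfc_universe forcing \<Rightarrow> 'v \<Rightarrow> 'v \<Rightarrow> 'v \<Rightarrow> bool" where
  "forces_eq P \<sigma> \<tau> p \<longleftrightarrow>
     (\<forall>c r. vpair c r \<in> elts \<sigma> \<longrightarrow> (\<forall>q\<in>below P p. leq P q r \<longrightarrow>
        dense_below P q (\<lambda>q'. \<exists>d s. vpair d s \<in> elts \<tau> \<and> leq P q' s \<and> forces_eq P c d q'))) \<and>
     (\<forall>d s. vpair d s \<in> elts \<tau> \<longrightarrow> (\<forall>q\<in>below P p. leq P q s \<longrightarrow>
        dense_below P q (\<lambda>q'. \<exists>c r. vpair c r \<in> elts \<sigma> \<and> leq P q' r \<and> forces_eq P c d q')))"
  by pat_completeness auto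
termination
  by (relation "inv_image mem_tc (\<lambda>(P, \<sigma>, \<tau>, p). \<sigma>)") (simp_all add: wf_mem_tc vpair_mem_tc)

declare forces_eq.simps [simp del]
declare conj_cong [fundef_cong del]

definition forces_mem :: "'v::zfc_universe forcing \<Rightarrow> 'v \<Rightarrow> 'v \<Rightarrow> 'v \<Rightarrow> bool" where
  "forces_mem P \<sigma> \<tau> p \<longleftrightarrow>
     dense_below P p (\<lambda>q. \<exists>c r. vpair c r \<in> elts \<tau> \<and> leq P q r \<and> forces_eq P \<sigma> c q)"

text \<open>
  A statement of the forcing language is represented by the predicate "\<open>p\<close> forces it" on
  conditions; the remaining clauses of the forcing relation become operations on such predicates.
  With \<open>S\<close> the collection of all names, \<open>forces_all S\<close> and \<open>forces_ex P S\<close> quantify over the generic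
  extension; with \<open>S\<close> a collection of objects of \<open>V\<close> (which enter atomic statements through their
  check names), they quantify over that ground model collection.
\<close>
definition forces_not :: "'v::zfc_universe forcing \<Rightarrow> ('v \<Rightarrow> bool) \<Rightarrow> 'v \<Rightarrow> bool" where
  "forces_not P \<phi> p \<longleftrightarrow> (\<forall>q\<in>below P p. \<not> \<phi> q)"

definition forces_and :: "('v \<Rightarrow> bool) \<Rightarrow> ('v \<Rightarrow> bool) \<Rightarrow> 'v \<Rightarrow> bool" where
  "forces_and \<phi> \<psi> p \<longleftrightarrow> \<phi> p \<and> \<psi> p"

definition forces_or ::
  "'v::zfc_universe forcing \<Rightarrow> ('v \<Rightarrow> bool) \<Rightarrow> ('v \<Rightarrow> bool) \<Rightarrow> 'v \<Rightarrow> bool" where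
  "forces_or P \<phi> \<psi> p \<longleftrightarrow> dense_below P p (\<lambda>q. \<phi> q \<or> \<psi> q)"

definition forces_imp ::
  "'v::zfc_universe forcing \<Rightarrow> ('v \<Rightarrow> bool) \<Rightarrow> ('v \<Rightarrow> bool) \<Rightarrow> 'v \<Rightarrow> bool" where
  "forces_imp P \<phi> \<psi> p \<longleftrightarrow> (\<forall>q\<in>below P p. \<phi> q \<longrightarrow> \<psi> q)"

definition forces_all :: "'a set \<Rightarrow> ('a \<Rightarrow> 'v \<Rightarrow> bool) \<Rightarrow> 'v \<Rightarrow> bool" where
  "forces_all S \<phi> p \<longleftrightarrow> (\<forall>x\<in>S. \<phi> x p)"

definition forces_ex ::
  "'v::zfc_universe forcing \<Rightarrow> 'a set \<Rightarrow> ('a \<Rightarrow> 'v \<Rightarrow> bool) \<Rightarrow> 'v \<Rightarrow> bool" where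
  "forces_ex P S \<phi> p \<longleftrightarrow> dense_below P p (\<lambda>q. \<exists>x\<in>S. \<phi> x q)"

definition names :: "'v::zfc_universe forcing \<Rightarrow> 'v set" where
  "names P = {\<tau>. is_name P \<tau>}"

text \<open>\<open>p\<close> forces \<open>Y\<close> to be an element of \<open>U\<close>, for a set \<open>Y\<close> of the ground model.\<close>
definition forces_ground_mem ::
  "'v::zfc_universe forcing \<Rightarrow> 'v set \<Rightarrow> 'v \<Rightarrow> 'v \<Rightarrow> bool" where
  "forces_ground_mem P Y U = forces_mem P (check_name P (vset Y)) U"


section \<open>Generic ultrafilters\<close>

definition forces_V_ultrafilter ::
  "'v::zfc_universe forcing \<Rightarrow> 'v \<Rightarrow> 'v \<Rightarrow> 'v \<Rightarrow> bool" where
  "forces_V_ultrafilter P \<kappa> U p \<longleftrightarrow>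
     forces_all (names P) (\<lambda>\<tau>. forces_imp P (forces_mem P \<tau> U)
       (forces_ex P (Pow (elts \<kappa>)) (\<lambda>Y. forces_eq P \<tau> (check_name P (vset Y))))) p \<and>
     forces_ground_mem P (elts \<kappa>) U p \<and>
     forces_not P (forces_ground_mem P {} U) p \<and>
     forces_all (Pow (elts \<kappa>)) (\<lambda>Y. forces_all {Z. Y \<subseteq> Z \<and> Z \<subseteq> elts \<kappa>} (\<lambda>Z.
       forces_imp P (forces_ground_mem P Y U) (forces_ground_mem P Z U))) p \<and>
     forces_all (Pow (elts \<kappa>)) (\<lambda>Y. forces_all (Pow (elts \<kappa>)) (\<lambda>Z.
       forces_imp P (forces_and (forces_ground_mem P Y U) (forces_ground_mem P Z U))
         (forces_ground_mem P (Y \<inter> Z) U))) p \<and>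
     forces_all (Pow (elts \<kappa>)) (\<lambda>Y.
       forces_or P (forces_ground_mem P Y U) (forces_ground_mem P (elts \<kappa> - Y) U)) p"

text \<open>Closure under diagonal intersections of sequences that lie in \<open>V\<close>.\<close>
definition forces_V_normal ::
  "'v::zfc_universe forcing \<Rightarrow> 'v \<Rightarrow> 'v \<Rightarrow> 'v \<Rightarrow> bool" where
  "forces_V_normal P \<kappa> U =
     forces_all {Y. \<forall>\<alpha>\<in>elts \<kappa>. Y \<alpha> \<subseteq> elts \<kappa>} (\<lambda>Y.
       forces_imp P (forces_all (elts \<kappa>) (\<lambda>\<alpha>. forces_ground_mem P (Y \<alpha>) U))
         (forces_ground_mem P (diagonal_intersection \<kappa> Y) U))"

definition forces_uniform ::
  "'v::zfc_universe forcing \<Rightarrow> 'v \<Rightarrow> 'v \<Rightarrow> 'v \<Rightarrow> bool" where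
  "forces_uniform P \<kappa> U =
     forces_all {Y. Y \<subseteq> elts \<kappa> \<and> \<not> |Y| =o |elts \<kappa>| } (\<lambda>Y. forces_not P (forces_ground_mem P Y U))"

definition forces_uniform_V_normal_V_ultrafilter ::
  "'v::zfc_universe forcing \<Rightarrow> 'v \<Rightarrow> 'v \<Rightarrow> 'v \<Rightarrow> bool" where
  "forces_uniform_V_normal_V_ultrafilter P \<kappa> U =
     forces_and (forces_V_ultrafilter P \<kappa> U)
       (forces_and (forces_V_normal P \<kappa> U) (forces_uniform P \<kappa> U))"

text \<open>
  The generic ultrapower of \<open>V\<close> by \<open>U\<close> consists of (classes of) functions on \<open>\<kappa>\<close> in \<open>V\<close>, with \<open>[g]\<close> a
  member of \<open>[f]\<close> iff \<open>{\<alpha> < \<kappa>. g \<alpha> \<in> f \<alpha>} \<in> U\<close>. It is well-founded iff in the extension every nonempty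
  set \<open>A\<close> of such functions has an element that is minimal for this relation. Functions on \<open>\<kappa>\<close> in \<open>V\<close>
  are the values of \<open>vgraph \<kappa>\<close>.
\<close>
definition forces_wf_ultrapower ::
  "'v::zfc_universe forcing \<Rightarrow> 'v \<Rightarrow> 'v \<Rightarrow> 'v \<Rightarrow> bool" where
  "forces_wf_ultrapower P \<kappa> U =
     (let in_A = (\<lambda>(f :: 'v \<Rightarrow> 'v) A. forces_mem P (check_name P (vgraph \<kappa> f)) A) in
      forces_all (names P) (\<lambda>A.
        forces_imp P
          (forces_and
            (forces_all (names P) (\<lambda>\<tau>. forces_imp P (forces_mem P \<tau> A)
              (forces_ex P UNIV (\<lambda>f. forces_eq P \<tau> (check_name P (vgraph \<kappa> f))))))
            (forces_ex P UNIV (\<lambda>f. in_A f A)))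
          (forces_ex P UNIV (\<lambda>f. forces_and (in_A f A)
            (forces_all UNIV (\<lambda>g. forces_imp P (in_A g A)
              (forces_not P (forces_ground_mem P {\<alpha> \<in> elts \<kappa>. g \<alpha> \<in> elts (f \<alpha>)} U))))))))"

text \<open>
  Uniformity is part of this notion: a principal ultrafilter is closed under diagonal intersections
  and has a well-founded ultrapower, but its embedding does not have critical point \<open>\<kappa>\<close>.
\<close>
definition generically_measurable :: "'v::zfc_universe \<Rightarrow> 'v forcing \<Rightarrow> bool" where
  "generically_measurable \<kappa> P \<longleftrightarrow>
     forces_ex P (names P) (\<lambda>U. forces_and (forces_uniform_V_normal_V_ultrafilter P \<kappa> U)
       (forces_wf_ultrapower P \<kappa> U)) (top_cond P)"

definition hopeless_ideal :: "'v::zfc_universe forcing \<Rightarrow> 'v \<Rightarrow> 'v \<Rightarrow> 'v set set" where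
  "hopeless_ideal P \<kappa> U =
     {Y. Y \<subseteq> elts \<kappa> \<and> forces_not P (forces_ground_mem P Y U) (top_cond P)}"


section \<open>The cut and choose game\<close>

definition cut_move :: "'v set \<Rightarrow> 'v set set \<Rightarrow> bool" where
  "cut_move X m \<longleftrightarrow> (\<exists>A B. m = {A, B} \<and> A \<union> B = X \<and> A \<inter> B = {})"

text \<open>
  A strategy for Choose maps the current round \<open>\<alpha>\<close>, the moves of Cut in the rounds up to and
  including \<open>\<alpha>\<close>, and the choices made in the rounds before \<open>\<alpha>\<close> to the choice made in round \<open>\<alpha>\<close>.
\<close>
type_synonym 'v strategy = "'v \<Rightarrow> ('v \<Rightarrow> 'v set set) \<Rightarrow> ('v \<Rightarrow> 'v set) \<Rightarrow> 'v set"

definition follows :: "'v::zfc_universe \<Rightarrow> 'v strategy \<Rightarrow> ('v \<Rightarrow> 'v set set) \<Rightarrow> ('v \<Rightarrow> 'v set) \<Rightarrow> bool" where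
  "follows \<gamma> \<sigma> c d \<longleftrightarrow>
     (\<forall>\<alpha>\<in>elts \<gamma>. d \<alpha> = \<sigma> \<alpha> (restrict c (insert \<alpha> (elts \<alpha>))) (restrict d (elts \<alpha>)))"

text \<open>The intersection of no choices at all is \<open>X\<close>.\<close>
definition choose_wins_run ::
  "'v::zfc_universe \<Rightarrow> 'v set \<Rightarrow> 'v set set \<Rightarrow> 'v \<Rightarrow> ('v \<Rightarrow> 'v set) \<Rightarrow> bool" where
  "choose_wins_run \<kappa> X I \<gamma> d \<longleftrightarrow>
     (\<forall>\<delta>\<in>elts \<gamma>. X \<inter> (\<Inter>\<alpha>\<in>elts \<delta>. d \<alpha>) \<in> positive_sets \<kappa> I)"

definition choose_winning_strategy ::
  "'v::zfc_universe \<Rightarrow> 'v set \<Rightarrow> 'v set set \<Rightarrow> 'v \<Rightarrow> 'v strategy \<Rightarrow> bool" where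
  "choose_winning_strategy \<kappa> X I \<gamma> \<sigma> \<longleftrightarrow>
     (\<forall>c d. (\<forall>\<alpha>\<in>elts \<gamma>. cut_move X (c \<alpha>)) \<and> follows \<gamma> \<sigma> c d \<longrightarrow>
        (\<forall>\<alpha>\<in>elts \<gamma>. d \<alpha> \<in> c \<alpha>) \<and> choose_wins_run \<kappa> X I \<gamma> d)"

end

theory Submission
  imports Defs
begin

text \<open>
  Since the maximal condition forces \<open>U\<close> to be an ultrafilter that is closed under diagonal
  intersections of ground model sequences, a set \<open>Y\<close> is hopeless iff every condition forces its
  complement into \<open>U\<close>. Read in this way, the hopeless sets inherit everything from the filter
  properties: the union of two hopeless sets and the diagonal union of \<open>\<kappa>\<close> many are hopeless because
  \<open>U\<close> is closed under binary and diagonal intersections, and bounded sets are hopeless because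
  \<open>U\<close> is uniform and \<open>\<kappa>\<close> is a cardinal.

  A positive set \<open>X\<close>, in turn, is one that some condition \<open>p\<close> forces into \<open>U\<close>. In the game starting
  from \<open>X\<close>, Choose builds on the side a decreasing sequence of conditions below \<open>p\<close>. In round \<open>\<alpha>\<close> the
  closure of \<open>P\<close> provides a lower bound of the conditions chosen so far, and since it forces \<open>X\<close>
  into \<open>U\<close>, it can be strengthened to a condition which forces one of the two pieces of \<open>X\<close> into \<open>U\<close>;
  Choose picks that piece (\<open>descent_exists\<close>). After \<open>\<delta> < \<gamma>\<close> rounds, a lower bound of the conditions
  forces all of the pieces chosen so far into \<open>U\<close>. Normality and the omission of bounded sets make
  \<open>U\<close> closed under intersections of \<open>\<delta> < \<kappa>\<close> many sets of a ground model sequence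
  (\<open>forced_small_Inter\<close>), so that the intersection of these pieces is again forced into \<open>U\<close> by some
  condition, which says that it is positive.
\<close>

section \<open>Ordinals\<close>

lemma not_mem_self: "x \<notin> elts x" for x :: "'v::zfc_universe"
  using wf_not_refl[OF foundation, of x] by simp

lemma is_ordinal_trans: "\<lbrakk>is_ordinal \<alpha>; x \<in> elts y; y \<in> elts \<alpha>\<rbrakk> \<Longrightarrow> x \<in> elts \<alpha>"
  unfolding is_ordinal_def by blast

lemma is_ordinal_elt_trans: "\<lbrakk>is_ordinal \<alpha>; z \<in> elts \<alpha>; x \<in> elts y; y \<in> elts z\<rbrakk> \<Longrightarrow> x \<in> elts z"
  unfolding is_ordinal_def by blast

lemma Field_ord_rel: "Field (ord_rel \<alpha>) = elts \<alpha>"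
  unfolding Field_def ord_rel_def by auto

lemma regular_cardinal_linear:
  assumes "regular_cardinal \<kappa>" "\<alpha> \<in> elts \<kappa>" "\<beta> \<in> elts \<kappa>"
  shows "\<alpha> \<in> elts \<beta> \<or> \<alpha> = \<beta> \<or> \<beta> \<in> elts \<alpha>"
proof -
  have "well_order_on (Field (ord_rel \<kappa>)) (ord_rel \<kappa>)"
    using assms(1) card_order_on_well_order_on unfolding regular_cardinal_def by blast
  then have "Total (ord_rel \<kappa>)" unfolding well_order_on_def linear_order_on_def by simp
  then show ?thesis
    using assms(2,3) unfolding total_on_def Field_ord_rel by (auto simp: ord_rel_def)
qed

lemma card_of_bounded:
  assumes "regular_cardinal \<kappa>" and "\<beta> \<in> elts \<kappa>" and "Y \<subseteq> elts \<beta>"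
  shows "|Y| <o |elts \<kappa>|"
proof -
  have card: "Card_order (ord_rel \<kappa>)" and ord: "is_ordinal \<kappa>"
    using assms(1) unfolding regular_cardinal_def by auto
  have "elts \<beta> \<subseteq> elts \<kappa>" using ord assms(2) unfolding is_ordinal_def by blast
  then have "underS (ord_rel \<kappa>) \<beta> = elts \<beta>"
    using assms(2) not_mem_self unfolding underS_def ord_rel_def by auto
  then have less: "|elts \<beta>| <o ord_rel \<kappa>"
    using card_of_underS[OF card, of \<beta>] assms(2) by (simp add: Field_ord_rel)
  have "ord_rel \<kappa> =o |elts \<kappa>|"
    using card_of_Field_ordIso[OF card] ordIso_symmetric by (simp add: Field_ord_rel)
  with less have "|elts \<beta>| <o |elts \<kappa>|" by (rule ordLess_ordIso_trans)
  with card_of_mono1[OF assms(3)] show ?thesis by (rule ordLeq_ordLess_trans)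
qed

section \<open>Ground model sets forced into the generic ultrafilter\<close>

locale forced_normal_ultrafilter =
  fixes \<kappa> U :: "'v::zfc_universe" and P :: "'v forcing"
  assumes regular: "regular_cardinal \<kappa>"
    and forcing: "notion_of_forcing P"
    and forced: "forces_uniform_V_normal_V_ultrafilter P \<kappa> U (top_cond P)"
begin

abbreviation forced_in :: "'v set \<Rightarrow> 'v \<Rightarrow> bool" where
  "forced_in Y p \<equiv> forces_ground_mem P Y U p"

abbreviation hopeless :: "'v set set" where
  "hopeless \<equiv> hopeless_ideal P \<kappa> U"

lemma leq_trans:
  "\<lbrakk>leq P p q; leq P q r; p \<in> elts (conds P); q \<in> elts (conds P); r \<in> elts (conds P)\<rbrakk> \<Longrightarrow> leq P p r"
  using forcing unfolding notion_of_forcing_def by blast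

lemma below_refl: "p \<in> elts (conds P) \<Longrightarrow> p \<in> below P p"
  using forcing unfolding notion_of_forcing_def below_def by blast

lemma below_conds: "q \<in> below P p \<Longrightarrow> q \<in> elts (conds P)"
  unfolding below_def by blast

lemma below_trans: "\<lbrakk>p \<in> elts (conds P); q \<in> below P p; r \<in> below P q\<rbrakk> \<Longrightarrow> r \<in> below P p"
  unfolding below_def using leq_trans by blast

lemma below_top: "below P (top_cond P) = elts (conds P)"
  using forcing unfolding notion_of_forcing_def below_def by blast

lemma forced_in_mono: "\<lbrakk>p \<in> elts (conds P); forced_in Y p; q \<in> below P p\<rbrakk> \<Longrightarrow> forced_in Y q"
  unfolding forces_ground_mem_def forces_mem_def dense_below_def using below_trans by blast

lemma forced_in_dense:
  assumes p: "p \<in> elts (conds P)" and dense: "dense_below P p (forced_in Y)"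
  shows "forced_in Y p"
  unfolding forces_ground_mem_def forces_mem_def dense_below_def
proof
  fix q assume q: "q \<in> below P p"
  then obtain r where r: "r \<in> below P q" "forced_in Y r"
    using dense unfolding dense_below_def by blast
  then obtain t where "t \<in> below P r" "\<exists>x s. vpair x s \<in> elts U \<and> leq P t s \<and>
      forces_eq P (check_name P (vset Y)) x t"
    using below_refl below_conds unfolding forces_ground_mem_def forces_mem_def dense_below_def
    by blast
  then show "\<exists>t\<in>below P q. \<exists>x s. vpair x s \<in> elts U \<and> leq P t s \<and>
      forces_eq P (check_name P (vset Y)) x t"
    using below_trans[OF below_conds[OF q] r(1)] by blast
qed

lemma forced_laws:
  shows "forced_in (elts \<kappa>) (top_cond P)"
    and "\<forall>p\<in>elts (conds P). \<not> forced_in {} p"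
    and "\<forall>Y\<in>Pow (elts \<kappa>). \<forall>Z\<in>{Z. Y \<subseteq> Z \<and> Z \<subseteq> elts \<kappa>}. \<forall>p\<in>elts (conds P).
      forced_in Y p \<longrightarrow> forced_in Z p"
    and "\<forall>Y\<in>Pow (elts \<kappa>). \<forall>Z\<in>Pow (elts \<kappa>). \<forall>p\<in>elts (conds P).
      forced_in Y p \<and> forced_in Z p \<longrightarrow> forced_in (Y \<inter> Z) p"
    and "\<forall>Y\<in>Pow (elts \<kappa>). \<forall>p\<in>elts (conds P).
      \<exists>q\<in>below P p. forced_in Y q \<or> forced_in (elts \<kappa> - Y) q"
    and "\<forall>Y\<in>{Y. \<forall>\<alpha>\<in>elts \<kappa>. Y \<alpha> \<subseteq> elts \<kappa>}. \<forall>p\<in>elts (conds P).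
      (\<forall>\<alpha>\<in>elts \<kappa>. forced_in (Y \<alpha>) p) \<longrightarrow> forced_in (diagonal_intersection \<kappa> Y) p"
    and "\<forall>Y\<in>{Y. Y \<subseteq> elts \<kappa> \<and> \<not> |Y| =o |elts \<kappa>| }. \<forall>p\<in>elts (conds P). \<not> forced_in Y p"
  using forced[unfolded forces_uniform_V_normal_V_ultrafilter_def forces_V_ultrafilter_def
    forces_V_normal_def forces_uniform_def forces_and_def forces_all_def forces_imp_def
    forces_not_def forces_or_def dense_below_def below_top]
  by - (elim conjE, assumption)+

lemma forced_in_carrier:
  assumes "p \<in> elts (conds P)"
  shows "forced_in (elts \<kappa>) p"
proof -
  have "top_cond P \<in> elts (conds P)"
    using forcing unfolding notion_of_forcing_def by blast
  then show ?thesis using forced_in_mono[OF _ forced_laws(1)] assms below_top by blast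
qed

lemma not_forced_in_empty: "p \<in> elts (conds P) \<Longrightarrow> \<not> forced_in {} p"
  using forced_laws(2) by blast

lemma forced_in_superset:
  "\<lbrakk>p \<in> elts (conds P); forced_in Y p; Y \<subseteq> Z; Z \<subseteq> elts \<kappa>\<rbrakk> \<Longrightarrow> forced_in Z p"
  using forced_laws(3) by blast

lemma forced_in_Int:
  "\<lbrakk>p \<in> elts (conds P); forced_in Y p; forced_in Z p; Y \<subseteq> elts \<kappa>; Z \<subseteq> elts \<kappa>\<rbrakk> \<Longrightarrow> forced_in (Y \<inter> Z) p"
  using forced_laws(4) by blast

lemma forced_in_decide:
  "\<lbrakk>p \<in> elts (conds P); Y \<subseteq> elts \<kappa>\<rbrakk> \<Longrightarrow> \<exists>q\<in>below P p. forced_in Y q \<or> forced_in (elts \<kappa> - Y) q"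
  using forced_laws(5) by blast

lemma forced_in_diagonal:
  assumes "p \<in> elts (conds P)" "\<And>\<alpha>. \<alpha> \<in> elts \<kappa> \<Longrightarrow> Y \<alpha> \<subseteq> elts \<kappa>"
    and "\<And>\<alpha>. \<alpha> \<in> elts \<kappa> \<Longrightarrow> forced_in (Y \<alpha>) p"
  shows "forced_in (diagonal_intersection \<kappa> Y) p"
proof -
  have "Y \<in> {Y. \<forall>\<alpha>\<in>elts \<kappa>. Y \<alpha> \<subseteq> elts \<kappa>}" using assms(2) by simp
  from forced_laws(6)[THEN bspec, OF this, THEN bspec, OF assms(1)] show ?thesis
    using assms(3) by simp
qed

lemma not_forced_in_small:
  "\<lbrakk>p \<in> elts (conds P); Y \<subseteq> elts \<kappa>; \<not> |Y| =o |elts \<kappa>|\<rbrakk> \<Longrightarrow> \<not> forced_in Y p"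
  using forced_laws(7) by blast

section \<open>The hopeless ideal\<close>

lemma hopeless_iff: "Y \<in> hopeless \<longleftrightarrow> Y \<subseteq> elts \<kappa> \<and> (\<forall>p\<in>elts (conds P). \<not> forced_in Y p)"
  unfolding hopeless_ideal_def forces_not_def below_top by simp

lemma positive_iff:
  "Y \<in> positive_sets \<kappa> hopeless \<longleftrightarrow> Y \<subseteq> elts \<kappa> \<and> (\<exists>p\<in>elts (conds P). forced_in Y p)"
  unfolding positive_sets_def using hopeless_iff by blast

text \<open>
  The complement of a hopeless set is forced outright and not just densely often, because the
  conditions deciding the set can only decide against it.
\<close>
lemma forced_in_complement:
  assumes "Y \<in> hopeless" "p \<in> elts (conds P)"
  shows "forced_in (elts \<kappa> - Y) p"
proof (rule forced_in_dense[OF assms(2)], unfold dense_below_def, intro ballI)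
  fix q assume "q \<in> below P p"
  then have "q \<in> elts (conds P)" by (rule below_conds)
  then show "\<exists>r\<in>below P q. forced_in (elts \<kappa> - Y) r"
    using forced_in_decide[of q Y] assms(1) hopeless_iff below_conds by blast
qed

lemma hopeless_if_forced_in_disjoint:
  assumes "Y \<subseteq> elts \<kappa>" "Z \<subseteq> elts \<kappa>" "Y \<inter> Z = {}"
    and "\<And>p. p \<in> elts (conds P) \<Longrightarrow> forced_in Z p"
  shows "Y \<in> hopeless"
  using assms forced_in_Int[of _ Y Z] not_forced_in_empty hopeless_iff by metis

lemma bounded_hopeless: "bounded_ideal \<kappa> \<subseteq> hopeless"
proof
  fix Y assume "Y \<in> bounded_ideal \<kappa>"
  then obtain \<beta> where Y: "Y \<subseteq> elts \<kappa>" and \<beta>: "\<beta> \<in> elts \<kappa>" "Y \<subseteq> elts \<beta>"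
    unfolding bounded_ideal_def by blast
  have "\<not> |Y| =o |elts \<kappa>|"
    using card_of_bounded[OF regular \<beta>] not_ordLess_ordIso by blast
  then show "Y \<in> hopeless" using Y not_forced_in_small hopeless_iff by blast
qed

lemma hopeless_Un:
  assumes "Y \<in> hopeless" "Z \<in> hopeless"
  shows "Y \<union> Z \<in> hopeless"
proof (rule hopeless_if_forced_in_disjoint)
  show "Y \<union> Z \<subseteq> elts \<kappa>" using assms hopeless_iff by blast
  show "(Y \<union> Z) \<inter> ((elts \<kappa> - Y) \<inter> (elts \<kappa> - Z)) = {}" by blast
  show "forced_in ((elts \<kappa> - Y) \<inter> (elts \<kappa> - Z)) p" if "p \<in> elts (conds P)" for p
    using that assms by (intro forced_in_Int forced_in_complement) auto
qed blast

lemma hopeless_diagonal_union: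
  assumes "\<And>\<alpha>. \<alpha> \<in> elts \<kappa> \<Longrightarrow> Y \<alpha> \<in> hopeless"
  shows "diagonal_union \<kappa> Y \<in> hopeless"
proof (rule hopeless_if_forced_in_disjoint)
  let ?D = "diagonal_intersection \<kappa> (\<lambda>\<alpha>. elts \<kappa> - Y \<alpha>)"
  show "diagonal_union \<kappa> Y \<subseteq> elts \<kappa>" unfolding diagonal_union_def by blast
  show "?D \<subseteq> elts \<kappa>" unfolding diagonal_intersection_def by blast
  show "diagonal_union \<kappa> Y \<inter> ?D = {}"
    unfolding diagonal_union_def diagonal_intersection_def by blast
  show "forced_in ?D p" if "p \<in> elts (conds P)" for p
    using that assms by (intro forced_in_diagonal forced_in_complement) auto
qed

lemma normal_ideal_hopeless: "normal_ideal_on \<kappa> hopeless"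
proof -
  have "top_cond P \<in> elts (conds P)"
    using forcing unfolding notion_of_forcing_def by blast
  then have "elts \<kappa> \<notin> hopeless" using forced_in_carrier hopeless_iff by blast
  moreover have "\<forall>Y\<in>hopeless. \<forall>Z. Z \<subseteq> Y \<longrightarrow> Z \<in> hopeless"
  proof (intro ballI allI impI)
    fix Y Z assume "Y \<in> hopeless" "Z \<subseteq> Y"
    then show "Z \<in> hopeless" unfolding hopeless_iff using forced_in_superset[of _ Z Y] by auto
  qed
  moreover have "hopeless \<subseteq> Pow (elts \<kappa>)" "{} \<in> hopeless"
    using hopeless_iff not_forced_in_empty by auto
  ultimately have "ideal_on \<kappa> hopeless" unfolding ideal_on_def using hopeless_Un by simp
  then show ?thesis unfolding normal_ideal_on_def using hopeless_diagonal_union by simp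
qed

text \<open>
  A sequence of length \<open>\<delta>\<close> becomes one of length \<open>\<kappa>\<close> when it is continued by \<open>\<kappa>\<close> itself. Above \<open>\<delta>\<close>,
  the diagonal intersection of the longer sequence is contained in the intersection of the given
  one, and the ordinals below \<open>\<delta>\<close> form a bounded, hence hopeless set.
\<close>
lemma forced_small_Inter:
  assumes p: "p \<in> elts (conds P)" and \<delta>: "\<delta> \<in> elts \<kappa>"
    and X: "X \<subseteq> elts \<kappa>" "forced_in X p"
    and Y: "\<And>\<alpha>. \<alpha> \<in> elts \<delta> \<Longrightarrow> Y \<alpha> \<subseteq> elts \<kappa>" "\<And>\<alpha>. \<alpha> \<in> elts \<delta> \<Longrightarrow> forced_in (Y \<alpha>) p"
  shows "forced_in (X \<inter> (\<Inter>\<alpha>\<in>elts \<delta>. Y \<alpha>)) p"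
proof -
  define Z where "Z \<alpha> = (if \<alpha> \<in> elts \<delta> then Y \<alpha> else elts \<kappa>)" for \<alpha>
  let ?D = "diagonal_intersection \<kappa> Z"
  have ord: "is_ordinal \<kappa>" using regular unfolding regular_cardinal_def by blast
  have "elts \<delta> \<in> hopeless"
    using bounded_hopeless \<delta> is_ordinal_trans[OF ord] unfolding bounded_ideal_def by blast
  then have tail: "forced_in (elts \<kappa> - elts \<delta>) p" using p by (rule forced_in_complement)
  have "forced_in ?D p"
    using p Y forced_in_carrier by (intro forced_in_diagonal) (auto simp: Z_def)
  moreover have "?D \<subseteq> elts \<kappa>" unfolding diagonal_intersection_def by blast
  ultimately have "forced_in (X \<inter> (?D \<inter> (elts \<kappa> - elts \<delta>))) p"
    using p X tail by (intro forced_in_Int) auto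
  moreover have "X \<inter> (?D \<inter> (elts \<kappa> - elts \<delta>)) \<subseteq> X \<inter> (\<Inter>\<alpha>\<in>elts \<delta>. Y \<alpha>)"
  proof -
    have "\<beta> \<in> Y \<alpha>" if "\<beta> \<in> ?D" "\<beta> \<notin> elts \<delta>" "\<alpha> \<in> elts \<delta>" for \<alpha> \<beta>
    proof -
      have \<beta>: "\<beta> \<in> elts \<kappa>" using that(1) unfolding diagonal_intersection_def by blast
      then have "\<delta> = \<beta> \<or> \<delta> \<in> elts \<beta>" using regular_cardinal_linear[OF regular \<delta>] that(2) by blast
      then have "\<alpha> \<in> elts \<beta>" using that(3) is_ordinal_elt_trans[OF ord \<beta>] by blast
      then have "\<beta> \<in> Z \<alpha>" using that(1) unfolding diagonal_intersection_def by blast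
      then show ?thesis using that(3) by (simp add: Z_def)
    qed
    then show ?thesis by blast
  qed
  ultimately show ?thesis using p X(1) by (meson forced_in_superset le_infI1)
qed

section \<open>The strategy of Choose\<close>

text \<open>
  The conditions are a function of the moves \<open>c\<close> of Cut alone: this makes them available to a
  strategy, which sees the moves of both players but not the conditions chosen before.
\<close>
function descent :: "'v \<Rightarrow> ('v \<Rightarrow> 'v set set) \<Rightarrow> 'v \<Rightarrow> 'v" where
  "descent p c \<alpha> = (SOME r. r \<in> elts (conds P) \<and>
     (\<forall>s\<in>insert p (descent p c ` elts \<alpha>). leq P r s) \<and> (\<exists>A\<in>c \<alpha>. forced_in A r))"
  by pat_completeness auto
termination
  by (relation "inv_image mem_tc (\<lambda>(p, c, \<alpha>). \<alpha>)") (simp_all add: wf_mem_tc elts_mem_tc)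

declare descent.simps [simp del]

definition follow_descent :: "'v \<Rightarrow> 'v strategy" where
  "follow_descent p \<alpha> c d = (SOME A. A \<in> c \<alpha> \<and> forced_in A (descent p c \<alpha>))"

text \<open>
  Truncating the moves of Cut, as the rules do for a strategy, does not change the conditions
  found so far; so the conditions computed in different rounds are those of a single sequence.
\<close>
lemma descent_cong:
  assumes "is_ordinal \<gamma>" "\<alpha> \<in> elts \<gamma>" "\<And>\<xi>. \<xi> \<in> insert \<alpha> (elts \<alpha>) \<Longrightarrow> c \<xi> = c' \<xi>"
  shows "descent p c \<alpha> = descent p c' \<alpha>"
  using assms(2,3)
proof (induction \<alpha> rule: wf_induct_rule[OF foundation])
  case (1 \<alpha>)
  have "descent p c \<xi> = descent p c' \<xi>" if \<xi>: "\<xi> \<in> elts \<alpha>" for \<xi>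
  proof (rule "1.IH")
    show "(\<xi>, \<alpha>) \<in> {(x, y). x \<in> elts y}" using \<xi> by simp
    show "\<xi> \<in> elts \<gamma>" using is_ordinal_trans[OF assms(1) \<xi> "1.prems"(1)] .
    show "c \<eta> = c' \<eta>" if "\<eta> \<in> insert \<xi> (elts \<xi>)" for \<eta>
      using that \<xi> is_ordinal_elt_trans[OF assms(1) "1.prems"(1)] "1.prems"(2) by blast
  qed
  then have "descent p c ` elts \<alpha> = descent p c' ` elts \<alpha>" by (rule image_cong[OF refl])
  moreover have "c \<alpha> = c' \<alpha>" using "1.prems"(2) by blast
  ultimately show ?case by (simp only: descent.simps[of p _ \<alpha>])
qed

text \<open>The empty sequence has any condition as a lower bound, so that \<open>p\<close> is needed separately.\<close>
lemma less_closed_below: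
  assumes "less_closed \<gamma> P" "p \<in> elts (conds P)" "\<delta> \<in> elts \<gamma>"
    and s: "\<And>\<alpha>. \<alpha> \<in> elts \<delta> \<Longrightarrow> s \<alpha> \<in> elts (conds P)" "\<And>\<alpha>. \<alpha> \<in> elts \<delta> \<Longrightarrow> leq P (s \<alpha>) p"
    and "\<And>\<alpha> \<beta>. \<lbrakk>\<beta> \<in> elts \<delta>; \<alpha> \<in> elts \<beta>\<rbrakk> \<Longrightarrow> leq P (s \<beta>) (s \<alpha>)"
  shows "\<exists>q\<in>below P p. \<forall>\<alpha>\<in>elts \<delta>. leq P q (s \<alpha>)"
proof (cases "elts \<delta> = {}")
  case True
  then show ?thesis using below_refl[OF assms(2)] by blast
next
  case False
  then obtain \<alpha> where \<alpha>: "\<alpha> \<in> elts \<delta>" by blast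
  have "(\<forall>\<alpha>\<in>elts \<delta>. s \<alpha> \<in> elts (conds P)) \<and> (\<forall>\<beta>\<in>elts \<delta>. \<forall>\<alpha>\<in>elts \<beta>. leq P (s \<beta>) (s \<alpha>))"
    using s(1) assms(6) by blast
  then obtain q where q: "q \<in> elts (conds P)" "\<forall>\<alpha>\<in>elts \<delta>. leq P q (s \<alpha>)"
    using assms(1,3) unfolding less_closed_def by blast
  then have "leq P q p" using leq_trans[of q "s \<alpha>" p] \<alpha> s assms(2) by blast
  then show ?thesis using q unfolding below_def by blast
qed

lemma forced_in_piece:
  assumes p: "p \<in> elts (conds P)" and X: "X \<subseteq> elts \<kappa>" "forced_in X p" and "cut_move X m"
  shows "\<exists>q\<in>below P p. \<exists>A\<in>m. forced_in A q"
proof -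
  obtain A B where m: "m = {A, B}" and AB: "A \<union> B = X" "A \<inter> B = {}"
    using assms(4) unfolding cut_move_def by blast
  obtain q where q: "q \<in> below P p" "forced_in A q \<or> forced_in (elts \<kappa> - A) q"
    using forced_in_decide[OF p, of A] AB X by blast
  have "forced_in B q" if "forced_in (elts \<kappa> - A) q"
  proof -
    have "forced_in (X \<inter> (elts \<kappa> - A)) q"
      using that q(1) X p forced_in_mono below_conds by (intro forced_in_Int) auto
    moreover have "X \<inter> (elts \<kappa> - A) = B" using AB X by blast
    ultimately show ?thesis by simp
  qed
  then show ?thesis using q m by blast
qed

lemma descent_exists:
  assumes "is_ordinal \<gamma>" "less_closed \<gamma> P"
    and p: "p \<in> elts (conds P)" and X: "X \<subseteq> elts \<kappa>" "forced_in X p"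
    and c: "\<And>\<alpha>. \<alpha> \<in> elts \<gamma> \<Longrightarrow> cut_move X (c \<alpha>)" and "\<alpha> \<in> elts \<gamma>"
  shows "descent p c \<alpha> \<in> elts (conds P) \<and>
    (\<forall>s\<in>insert p (descent p c ` elts \<alpha>). leq P (descent p c \<alpha>) s) \<and>
    (\<exists>A\<in>c \<alpha>. forced_in A (descent p c \<alpha>))"
  using assms(7)
proof (induction \<alpha> rule: wf_induct_rule[OF foundation])
  case (1 \<alpha>)
  have IH: "descent p c \<beta> \<in> elts (conds P)" "leq P (descent p c \<beta>) p"
    "\<xi> \<in> elts \<beta> \<Longrightarrow> leq P (descent p c \<beta>) (descent p c \<xi>)" if "\<beta> \<in> elts \<alpha>" for \<beta> \<xi>
    using "1.IH"[of \<beta>] that is_ordinal_trans[OF assms(1) that "1.prems"] by auto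
  obtain q where q: "q \<in> below P p" "\<forall>\<beta>\<in>elts \<alpha>. leq P q (descent p c \<beta>)"
    using less_closed_below[OF assms(2) p "1.prems", of "descent p c"] IH by blast
  obtain r A where r: "r \<in> below P q" "A \<in> c \<alpha>" "forced_in A r"
    using forced_in_piece[of q X "c \<alpha>"] X c[OF "1.prems"] q(1) forced_in_mono[OF p] below_conds
    by blast
  have "leq P r s" if "s \<in> insert p (descent p c ` elts \<alpha>)" for s
    using that q r(1) IH(1) p leq_trans[of r q s] unfolding below_def by auto
  then have "\<exists>r. r \<in> elts (conds P) \<and>
      (\<forall>s\<in>insert p (descent p c ` elts \<alpha>). leq P r s) \<and> (\<exists>A\<in>c \<alpha>. forced_in A r)"
    using r below_conds by blast
  then show ?case by (subst (1 2 4) descent.simps) (rule someI_ex)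
qed

lemma follow_descent_wins:
  assumes \<gamma>: "regular_cardinal \<gamma>" "\<gamma> \<in> elts \<kappa> \<or> \<gamma> = \<kappa>" "less_closed \<gamma> P"
    and p: "p \<in> elts (conds P)" and X: "X \<subseteq> elts \<kappa>" "forced_in X p"
  shows "choose_winning_strategy \<kappa> X hopeless \<gamma> (follow_descent p)"
  unfolding choose_winning_strategy_def
proof (intro allI impI, elim conjE)
  fix c d
  assume "\<forall>\<alpha>\<in>elts \<gamma>. cut_move X (c \<alpha>)" and follows: "follows \<gamma> (follow_descent p) c d"
  then have cut: "\<And>\<alpha>. \<alpha> \<in> elts \<gamma> \<Longrightarrow> cut_move X (c \<alpha>)" by blast
  have ord: "is_ordinal \<gamma>" using \<gamma>(1) unfolding regular_cardinal_def by blast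
  have descent: "descent p c \<alpha> \<in> elts (conds P)" "leq P (descent p c \<alpha>) p"
    "\<xi> \<in> elts \<alpha> \<Longrightarrow> leq P (descent p c \<alpha>) (descent p c \<xi>)"
    "\<exists>A. A \<in> c \<alpha> \<and> forced_in A (descent p c \<alpha>)" if "\<alpha> \<in> elts \<gamma>" for \<alpha> \<xi>
    using descent_exists[where c = c and \<alpha> = \<alpha>, OF ord \<gamma>(3) p X cut that] by auto
  have choice: "d \<alpha> \<in> c \<alpha> \<and> forced_in (d \<alpha>) (descent p c \<alpha>)" if \<alpha>: "\<alpha> \<in> elts \<gamma>" for \<alpha>
  proof -
    have "descent p (restrict c (insert \<alpha> (elts \<alpha>))) \<alpha> = descent p c \<alpha>"
      by (rule descent_cong[OF ord \<alpha>]) simp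
    then have "d \<alpha> = (SOME A. A \<in> c \<alpha> \<and> forced_in A (descent p c \<alpha>))"
      using follows \<alpha> unfolding follows_def follow_descent_def by simp
    then show ?thesis using someI_ex[OF descent(4)[OF \<alpha>]] by simp
  qed
  have "X \<inter> (\<Inter>\<alpha>\<in>elts \<delta>. d \<alpha>) \<in> positive_sets \<kappa> hopeless" if \<delta>: "\<delta> \<in> elts \<gamma>" for \<delta>
  proof -
    have mem: "\<alpha> \<in> elts \<gamma>" if "\<alpha> \<in> elts \<delta>" for \<alpha> using is_ordinal_trans[OF ord that \<delta>] .
    obtain q where q: "q \<in> below P p" "\<forall>\<alpha>\<in>elts \<delta>. leq P q (descent p c \<alpha>)"
      using less_closed_below[OF \<gamma>(3) p \<delta>, of "descent p c"] descent(1-3)[OF mem] by blast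
    have q_cond: "q \<in> elts (conds P)" using q(1) by (rule below_conds)
    have "\<delta> \<in> elts \<kappa>"
      using \<gamma>(2) \<delta> regular is_ordinal_trans unfolding regular_cardinal_def by blast
    moreover have "forced_in X q" using forced_in_mono[OF p X(2) q(1)] .
    moreover have "d \<alpha> \<subseteq> elts \<kappa>" if "\<alpha> \<in> elts \<delta>" for \<alpha>
      using choice[OF mem[OF that]] cut[OF mem[OF that]] X(1) unfolding cut_move_def by blast
    moreover have "forced_in (d \<alpha>) q" if "\<alpha> \<in> elts \<delta>" for \<alpha>
      using that choice[OF mem[OF that]] descent(1)[OF mem[OF that]] q(2) q_cond
        forced_in_mono[of "descent p c \<alpha>" "d \<alpha>" q]
      unfolding below_def by blast
    ultimately have "forced_in (X \<inter> (\<Inter>\<alpha>\<in>elts \<delta>. d \<alpha>)) q"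
      using q_cond X(1) by (intro forced_small_Inter) auto
    then show ?thesis using q_cond X(1) positive_iff by blast
  qed
  then show "(\<forall>\<alpha>\<in>elts \<gamma>. d \<alpha> \<in> c \<alpha>) \<and> choose_wins_run \<kappa> X hopeless \<gamma> d"
    using choice unfolding choose_wins_run_def by blast
qed

end

theorem mainTheorem3:
  fixes \<kappa> \<gamma> U :: "'v::zfc_universe" and P :: "'v forcing"
  assumes "regular_cardinal \<kappa>" and "natLeq <o |elts \<kappa>|"
    and "regular_cardinal \<gamma>" and "\<gamma> \<in> elts \<kappa> \<or> \<gamma> = \<kappa>"
    and "notion_of_forcing P" and "less_closed \<gamma> P" and "generically_measurable \<kappa> P"
    and "is_name P U" and "forces_uniform_V_normal_V_ultrafilter P \<kappa> U (top_cond P)"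
  shows "bounded_ideal \<kappa> \<subseteq> hopeless_ideal P \<kappa> U \<and>
    normal_ideal_on \<kappa> (hopeless_ideal P \<kappa> U) \<and>
    (\<forall>X\<in>positive_sets \<kappa> (hopeless_ideal P \<kappa> U).
       \<exists>\<sigma>. choose_winning_strategy \<kappa> X (hopeless_ideal P \<kappa> U) \<gamma> \<sigma>)"
proof -
  interpret forced_normal_ultrafilter \<kappa> U P
    using assms(1,5,9) by unfold_locales
  show ?thesis
  proof (intro conjI ballI)
    fix X assume "X \<in> positive_sets \<kappa> hopeless"
    then obtain p where "X \<subseteq> elts \<kappa>" "p \<in> elts (conds P)" "forced_in X p"
      using positive_iff by blast
    then have "choose_winning_strategy \<kappa> X hopeless \<gamma> (follow_descent p)"
      using follow_descent_wins[OF assms(3,4,6)] by simp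
    then show "\<exists>\<sigma>. choose_winning_strategy \<kappa> X hopeless \<gamma> \<sigma>"
      by (rule exI[where x = "follow_descent p"])
  qed (fact bounded_hopeless, fact normal_ideal_hopeless)
qed

end
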